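(* Consider a set $V$ of $N$ homogeneous agents (one leader and $N-1$ followers) with dynamics $\dot x = f(x,u)$, safe set $\mathcal{S}$ and minimum separation distance $\delta>0$, satisfying the Communications assumption and the Sequential Consistency assumption (both given in the context). Suppose that: 1. the leader trajectory $([t_0,t_f],p_L,u_L)$ is a valid trajectory backup set, with a known curvature margin $\epsilon\in\mathbb{R}_{\ge 0}$ (so $\epsilon$ also has the joint-separation property, as defined in the context); 2. all agents possess valid committed trajectories at time $t_0$, and update their committed trajectories according to multi-agent gatekeeper. Then for all $t\ge t_0$, every agent $i$ remains in the safe set, $x_i(t)\in\mathcal{S}$, and inter-agent safety is maintained: $\|r_i(t)-r_j(t)\|\ge\delta$ for all $i\ne j$.
   Context: **System.** $\mathcal{X}\subseteq\mathbb{R}^n$ is the state space, $\mathcal{U}\subseteq\mathbb{R}^m$ the input set, and $f:\mathcal{X}\times\mathcal{U}\to\mathbb{R}^n$ is piecewise continuous and locally Lipschitz in $x$ and $u$. The position component of a state $x$ is denoted $r\in\mathbb{R}^d$, $d\in\{2,3\}$. The same sub/superscripts are used for a state trajectory $p$ and its position component $r$ (e.g. $r_L(t)$ is the position component of $p_L(t)$). $\mathcal{X}_{\rm obs}\subset\mathcal{X}$ is a set of static obstacles and $\mathcal{S}=\mathcal{X}\setminus\mathcal{X}_{\rm obs}$ is the safe set. Agent $i$ has state $x_i(t)$ evolving by $\dot x_i=f(x_i,u_i)$. **Trajectory.** A trajectory is a tuple $(T,p,u)$ with $T\subseteq\mathbb{R}_{\ge0}$ an interval, $p:T\to\mathcal{X}$,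 $u:T\to\mathcal{U}$ and $\dot p(t)=f(p(t),u(t))$ on $T$ (for piecewise-defined trajectories, $p$ is continuous and the equation holds on each piece). The arc length along a trajectory is $d(t_1,t_2)=\int_{t_1}^{t_2}\|\dot r(\tau)\|\,d\tau$. **Leader trajectory and valid trajectory backup set.** The leader executes a pre-computed trajectory $([t_0,t_f],p_L,u_L)$. Whenever $p_L,u_L$ are evaluated past $t_f$, they are understood as continued to a trajectory on $[t_0,\infty)$. It is a *valid trajectory backup set* if: (i) $p_L(t)\in\mathcal{S}$ for all $t\in[t_0,t_f]$; (ii) it is dynamically feasible (i.e. it is a trajectory of the system); (iii) there is a curvature margin $\epsilon\ge0$ such that for all $t_1,t_2\in[t_0,t_f]$ and all $\tau\ge0$, $$d(t_1,t_2)\ge\delta+\epsilon\ \Longrightarrow\ \|r_L(t_1+\tau)-r_L(t_2+\tau)\|\ge\delta,$$ with $d$ the arc length along the leader trajectory. *Joint-separation property of $\epsilon$:* if two agents $i,j$ follow the leader path from times $t_i,t_j$ on, starting at path parameters $t_{Li},t_{Lj}$ (so $p_i(t)=p_L(t_{Li}+t-t_i)$ for $t\ge t_i$, and similarly for $j$), and with $t_c=\max(t_i,t_j)$ the path parameters at time $t_c$ lie in $[t_0,t_f]$ and satisfy $d(t_{Li}+t_c-t_i,\,t_{Lj}+t_c-t_j)\ge\delta+\epsilon$, then $\|r_i(t)-r_j(t)\|\ge\delta$ for all $t\ge t_c$. **Backup set.** The leader path serves as the backup set $\mathcal{C}$: an agent in state $p_L(t_L)$ at time $t_{\rm now}$ uses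 the trajectory backup controller $u_L(t_L+(t-t_{\rm now}))$, $t\ge t_{\rm now}$, and so follows $p_L(t_L+(t-t_{\rm now}))$. **Nominal, backup and candidate trajectories.** Agent $i$ plans at iterations $k_i\in\mathbb{N}$ occurring at times $t_{k_i}<t_{k_i+1}$ (iteration $0$ is at $t_0$), only finitely many in any bounded time interval. At iteration $k_i$, from its current state $x_i(t_{k_i})$, it has a nominal trajectory $([t_{k_i},t_{k_i}+T_H],p^{\rm nom}_{k_i,i},u^{\rm nom}_{k_i,i})$, with planning horizon $T_H\ge0$; it may be unsafe. For a switch time $t_s\in[t_{k_i},t_{k_i}+T_H]$, a backup trajectory on $[t_s,\infty)$ starts at $p^{\rm nom}_{k_i,i}(t_s)$, reaches the backup set at time $t_s+T_B$ for a finite $T_B\ge0$ (a "join" maneuver to a point $p_L(t_{Li})$ of the leader path), and uses the backup controller for all $t\ge t_s+T_B$. The candidate trajectory with switch time $t_s$, $(p^{{\rm can},t_s}_{k_i,i},u^{{\rm can},t_s}_{k_i,i})$ on $[t_{k_i},\infty)$, equals the nominal trajectory on $[t_{k_i},t_s)$ and the backup trajectory on $[t_s,\infty)$. **Valid.** A candidate trajectory of agent $i$ at iteration $k_i$ is *valid* if (1) $p^{\rm can}_{k_i,i}(t)\in\mathcal{S}$ for all $t\ge t_{k_i}$; (2) $p^{\rm can}_{k_i,i}(t)\in\mathcal{C}$ for all $t\ge t_s+T_B$; (3) $\|r^{\rm can}_{k_i,i}(t)-r^{\rm com}_{k_j,j}(t)\|\ge\delta$ for all $j\ne i$ and all $t\ge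 t_{k_i}$, where $r^{\rm com}_{k_j,j}$ is the position component of the committed trajectory of agent $j$ in force at time $t_{k_i}$. "All agents possess valid committed trajectories at $t_0$" means each agent has a committed trajectory on $[t_0,\infty)$, starting from its state at $t_0$, satisfying (1)–(3) with $t_{k_i}=t_0$ with respect to the time-$t_0$ committed trajectories of all other agents. **Multi-agent gatekeeper update (committed trajectories).** At each iteration $k_i$, follower $i$ receives the committed trajectories currently in force of all other agents and lets $\mathcal{I}_{k_i,i}$ be the set of switch times (searched over discrete time steps in $[t_{k_i},t_{k_i}+T_H]$) whose candidate trajectory is valid. If $\mathcal{I}_{k_i,i}\ne\emptyset$, the new committed trajectory $(p^{\rm com}_{k_i,i},u^{\rm com}_{k_i,i})$ is the candidate with switch time $\max\mathcal{I}_{k_i,i}$. Otherwise the agent keeps its previous committed trajectory $(p^{\rm com}_{k_i-1,i},u^{\rm com}_{k_i-1,i})$. Each agent executes its committed trajectory until a new one is committed: $x_i(t)=p^{\rm com}_{k_i,i}(t)$ for $t$ from $t_{k_i}$ until the next iteration $t_{k_i+1}$ (for all later $t$ if there is none). The leader's committed trajectory is the leader trajectory throughout; it performs no replanning. **Communications assumption.** The agents' undirected communication graph is fully connected, with no communication delay or bandwidth limitation (so each agent has access to the currently committed trajectories of all others). **Sequential Consistency assumption.** Planning iterations of different agents after the initialization at $t_0$ occur at distinct times ($t_{k_i}\ne t_{k_j}$ for $i\ne j$), and computation time is negligible, i.e. each iteration is instantaneous. *)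

theory Defs
  imports "HOL-Analysis.Analysis"
begin

record ('n, 'm, 'd) sys =
  state_space :: "(real ^ 'n::finite) set"
  input_set :: "(real ^ 'm::finite) set"
  dyn :: "real ^ 'n \<Rightarrow> real ^ 'm \<Rightarrow> real ^ 'n"
  obstacles :: "(real ^ 'n) set"
  pos_coord :: "'d::finite \<Rightarrow> 'n"  \<comment> \<open>which state coordinates are the position coordinates\<close>

definition safe_set :: "('n::finite, 'm::finite, 'd::finite) sys \<Rightarrow> (real ^ 'n) set" where
  "safe_set \<Sigma> = state_space \<Sigma> - obstacles \<Sigma>"

definition pos :: "('n::finite, 'm::finite, 'd::finite) sys \<Rightarrow> real ^ 'n \<Rightarrow> real ^ 'd" where
  "pos \<Sigma> x = (\<chi> c. x $ pos_coord \<Sigma> c)"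

text \<open>
  Local Lipschitz continuity of the dynamics in both arguments (each locally uniformly in the
  other one) entails joint continuity, so piecewise continuity need not be required separately.
\<close>

definition control_system :: "('n::finite, 'm::finite, 'd::finite) sys \<Rightarrow> bool" where
  "control_system \<Sigma> \<longleftrightarrow>
     local_lipschitz (input_set \<Sigma>) (state_space \<Sigma>) (\<lambda>u x. dyn \<Sigma> x u) \<and>
     local_lipschitz (state_space \<Sigma>) (input_set \<Sigma>) (\<lambda>x u. dyn \<Sigma> x u) \<and>
     obstacles \<Sigma> \<subseteq> state_space \<Sigma> \<and>
     inj (pos_coord \<Sigma>) \<and>
     CARD('d) \<in> {2, 3}"

text \<open>
  State and input as functions of time; the time interval is kept separate, and values outside
  of it are irrelevant.
\<close>

type_synonym ('n, 'm) traj = "(real \<Rightarrow> real ^ 'n) \<times> (real \<Rightarrow> real ^ 'm)"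

text \<open>
  Trajectories may be piecewise defined: \<open>B\<close> is the (locally finite) set of points at which
  two pieces meet.
\<close>

definition trajectory ::
  "('n::finite, 'm::finite, 'd::finite) sys \<Rightarrow> real set \<Rightarrow> ('n, 'm) traj \<Rightarrow> bool" where
  "trajectory \<Sigma> T = (\<lambda>(p, u).
     is_interval T \<and> T \<subseteq> {0..} \<and>
     (\<forall>t\<in>T. p t \<in> state_space \<Sigma> \<and> u t \<in> input_set \<Sigma>) \<and>
     continuous_on T p \<and>
     (\<exists>B. (\<forall>a b. finite (B \<inter> {a..b})) \<and>
          (\<forall>t\<in>T - B. (p has_vector_derivative dyn \<Sigma> (p t) (u t)) (at t within T))))"

text \<open>
  The arc length is taken as a nonnegative Lebesgue integral, so that it is infinite
  rather than undefined when the speed is not integrable. It does not depend on the order of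
  \<open>t1\<close> and \<open>t2\<close>.
\<close>

definition arc_length ::
  "('n::finite, 'm::finite, 'd::finite) sys \<Rightarrow> (real \<Rightarrow> real ^ 'n) \<Rightarrow> real \<Rightarrow> real \<Rightarrow> ennreal" where
  "arc_length \<Sigma> p t1 t2 =
     (\<integral>\<^sup>+ \<tau>\<in>{min t1 t2..max t1 t2}.
        ennreal (norm (vector_derivative (\<lambda>s. pos \<Sigma> (p s)) (at \<tau>))) \<partial>lborel)"

definition curvature_margin ::
  "('n::finite, 'm::finite, 'd::finite) sys \<Rightarrow> real \<Rightarrow> real \<Rightarrow> real \<Rightarrow> ('n, 'm) traj \<Rightarrow> real \<Rightarrow> bool" where
  "curvature_margin \<Sigma> \<delta> t0 tf ld \<epsilon> \<longleftrightarrow> \<epsilon> \<ge> 0 \<and>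
     (\<forall>t1\<in>{t0..tf}. \<forall>t2\<in>{t0..tf}. \<forall>\<tau>\<ge>0.
        arc_length \<Sigma> (fst ld) t1 t2 \<ge> ennreal (\<delta> + \<epsilon>) \<longrightarrow>
        norm (pos \<Sigma> (fst ld (t1 + \<tau>)) - pos \<Sigma> (fst ld (t2 + \<tau>))) \<ge> \<delta>)"

text \<open>
  The leader trajectory \<open>ld\<close> is pre-computed on \<open>{t0..tf}\<close>; the pair \<open>ld\<close> stands for a fixed
  continuation of it to \<open>{t0..}\<close>.
\<close>

definition valid_trajectory_backup_set ::
  "('n::finite, 'm::finite, 'd::finite) sys \<Rightarrow> real \<Rightarrow> real \<Rightarrow> real \<Rightarrow> ('n, 'm) traj \<Rightarrow> bool" where
  "valid_trajectory_backup_set \<Sigma> \<delta> t0 tf ld \<longleftrightarrow>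
     (\<forall>t\<in>{t0..tf}. fst ld t \<in> safe_set \<Sigma>) \<and>
     trajectory \<Sigma> {t0..tf} ld \<and>
     (\<exists>\<epsilon>. curvature_margin \<Sigma> \<delta> t0 tf ld \<epsilon>)"

definition joint_separation ::
  "('n::finite, 'm::finite, 'd::finite) sys \<Rightarrow> real \<Rightarrow> real \<Rightarrow> real \<Rightarrow> ('n, 'm) traj \<Rightarrow> real \<Rightarrow> bool" where
  "joint_separation \<Sigma> \<delta> t0 tf ld \<epsilon> \<longleftrightarrow>
     (\<forall>p_i p_j ti tj tLi tLj.
        t0 \<le> ti \<and> t0 \<le> tj \<and> t0 \<le> tLi \<and> t0 \<le> tLj \<and>
        (\<forall>t\<ge>ti. p_i t = fst ld (tLi + t - ti)) \<and>
        (\<forall>t\<ge>tj. p_j t = fst ld (tLj + t - tj)) \<longrightarrow>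
        (let tc = max ti tj in
           tLi + tc - ti \<in> {t0..tf} \<and> tLj + tc - tj \<in> {t0..tf} \<and>
           arc_length \<Sigma> (fst ld) (tLi + tc - ti) (tLj + tc - tj) \<ge> ennreal (\<delta> + \<epsilon>) \<longrightarrow>
           (\<forall>t\<ge>tc. norm (pos \<Sigma> (p_i t) - pos \<Sigma> (p_j t)) \<ge> \<delta>)))"

text \<open>The leader path includes the continuation, since agents follow it for all future times.\<close>

definition backup_set :: "real \<Rightarrow> ('n::finite, 'm::finite) traj \<Rightarrow> (real ^ 'n) set" where
  "backup_set t0 ld = fst ld ` {t0..}"

text \<open>
  Data of one run of the multi-agent system. An agent may plan finitely or infinitely often:
  \<open>iters i\<close> is the set of its iteration indices, an initial segment of the naturals.
  Iteration \<open>0\<close> is the initialization.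
\<close>

record ('a, 'n, 'm) run =
  iters :: "'a \<Rightarrow> nat set"
  iter_time :: "'a \<Rightarrow> nat \<Rightarrow> real"
  nominal :: "'a \<Rightarrow> nat \<Rightarrow> ('n::finite, 'm::finite) traj"
  switch_steps :: "'a \<Rightarrow> nat \<Rightarrow> real set"
    \<comment> \<open>the discrete time steps over which switch times are searched\<close>
  backup :: "'a \<Rightarrow> nat \<Rightarrow> real \<Rightarrow> ('n, 'm) traj"
  join_duration :: "'a \<Rightarrow> nat \<Rightarrow> real \<Rightarrow> real"
  received :: "'a \<Rightarrow> nat \<Rightarrow> 'a \<Rightarrow> ('n, 'm) traj"
    \<comment> \<open>\<open>received i k j\<close> is what \<open>i\<close> receives from \<open>j\<close> at iteration \<open>k\<close> of \<open>i\<close>\<close>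
  committed :: "'a \<Rightarrow> nat \<Rightarrow> ('n, 'm) traj"
  agent_state :: "'a \<Rightarrow> real \<Rightarrow> real ^ 'n"
  agent_input :: "'a \<Rightarrow> real \<Rightarrow> real ^ 'm"

definition planning_times :: "'a set \<Rightarrow> real \<Rightarrow> ('a, 'n::finite, 'm::finite) run \<Rightarrow> bool" where
  "planning_times V t0 R \<longleftrightarrow>
     (\<forall>i\<in>V.
        0 \<in> iters R i \<and> iter_time R i 0 = t0 \<and>
        (\<forall>k. Suc k \<in> iters R i \<longrightarrow> k \<in> iters R i \<and> iter_time R i k < iter_time R i (Suc k)) \<and>
        (\<forall>b. finite {k \<in> iters R i. iter_time R i k \<le> b}))"

definition in_force :: "('a, 'n::finite, 'm::finite) run \<Rightarrow> 'a \<Rightarrow> real \<Rightarrow> ('n, 'm) traj" where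
  "in_force R j t = committed R j (Max {k \<in> iters R j. iter_time R j k \<le> t})"

definition executes_committed ::
  "('n::finite, 'm::finite, 'd::finite) sys \<Rightarrow> 'a set \<Rightarrow> real \<Rightarrow> ('a, 'n, 'm) run \<Rightarrow> bool" where
  "executes_committed \<Sigma> V t0 R \<longleftrightarrow>
     (\<forall>i\<in>V.
        trajectory \<Sigma> {t0..} (agent_state R i, agent_input R i) \<and>
        (\<forall>k\<in>iters R i. \<forall>t\<ge>iter_time R i k.
           (Suc k \<in> iters R i \<longrightarrow> t < iter_time R i (Suc k)) \<longrightarrow>
           agent_state R i t = fst (committed R i k) t \<and>
           agent_input R i t = snd (committed R i k) t))"

definition communications :: "'a set \<Rightarrow> ('a \<times> 'a) set \<Rightarrow> ('a, 'n::finite, 'm::finite) run \<Rightarrow> bool" where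
  "communications V E R \<longleftrightarrow>
     E \<subseteq> V \<times> V \<and> sym E \<and> (\<forall>i\<in>V. \<forall>j\<in>V. i \<noteq> j \<longrightarrow> (i, j) \<in> E) \<and>
     (\<forall>(i, j)\<in>E. \<forall>k\<in>iters R i. received R i k j = in_force R j (iter_time R i k))"

definition sequentially_consistent :: "'a set \<Rightarrow> ('a, 'n::finite, 'm::finite) run \<Rightarrow> bool" where
  "sequentially_consistent V R \<longleftrightarrow>
     (\<forall>i\<in>V. \<forall>j\<in>V. i \<noteq> j \<longrightarrow>
        (\<forall>k\<in>iters R i - {0}. \<forall>l\<in>iters R j - {0}. iter_time R i k \<noteq> iter_time R j l))"

text \<open>
  Validity of a trajectory \<open>p\<close> of agent \<open>i\<close> planned at time \<open>tk\<close>, which is to be in the backup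
  set from time \<open>tB\<close> (switch time plus duration of the join maneuver) on; \<open>others j\<close> is
  the committed trajectory of agent \<open>j\<close>.
\<close>

definition valid ::
  "('n::finite, 'm::finite, 'd::finite) sys \<Rightarrow> real \<Rightarrow> 'a set \<Rightarrow> real \<Rightarrow> ('n, 'm) traj \<Rightarrow>
   ('a \<Rightarrow> ('n, 'm) traj) \<Rightarrow> 'a \<Rightarrow> real \<Rightarrow> real \<Rightarrow> ('n, 'm) traj \<Rightarrow> bool" where
  "valid \<Sigma> \<delta> V t0 ld others i tk tB p \<longleftrightarrow>
     (\<forall>t\<ge>tk. fst p t \<in> safe_set \<Sigma>) \<and>
     (\<forall>t\<ge>tB. fst p t \<in> backup_set t0 ld) \<and>
     (\<forall>j\<in>V - {i}. \<forall>t\<ge>tk. norm (pos \<Sigma> (fst p t) - pos \<Sigma> (fst (others j) t)) \<ge> \<delta>)"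

text \<open>
  A backup trajectory from state \<open>x\<close> at time \<open>ts\<close>, joining the leader path after a duration
  \<open>TB\<close> at \<open>fst ld tL\<close> and using the trajectory backup controller from then on.
\<close>

definition backup_trajectory ::
  "('n::finite, 'm::finite, 'd::finite) sys \<Rightarrow> real \<Rightarrow> ('n, 'm) traj \<Rightarrow>
   real \<Rightarrow> real ^ 'n \<Rightarrow> real \<Rightarrow> ('n, 'm) traj \<Rightarrow> bool" where
  "backup_trajectory \<Sigma> t0 ld ts x TB b \<longleftrightarrow>
     trajectory \<Sigma> {ts..} b \<and> fst b ts = x \<and> TB \<ge> 0 \<and>
     (\<exists>tL\<ge>t0. \<forall>t\<ge>ts + TB.
        fst b t = fst ld (tL + (t - (ts + TB))) \<and>
        snd b t = snd ld (tL + (t - (ts + TB))))"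

definition planning_data ::
  "('n::finite, 'm::finite, 'd::finite) sys \<Rightarrow> real \<Rightarrow> real \<Rightarrow> ('n, 'm) traj \<Rightarrow>
   ('a, 'n, 'm) run \<Rightarrow> 'a \<Rightarrow> nat \<Rightarrow> bool" where
  "planning_data \<Sigma> TH t0 ld R i k \<longleftrightarrow>
     (let tk = iter_time R i k in
        trajectory \<Sigma> {tk..tk + TH} (nominal R i k) \<and>
        fst (nominal R i k) tk = agent_state R i tk \<and>
        finite (switch_steps R i k) \<and> switch_steps R i k \<subseteq> {tk..tk + TH} \<and>
        (\<forall>ts\<in>switch_steps R i k.
           backup_trajectory \<Sigma> t0 ld ts (fst (nominal R i k) ts)
             (join_duration R i k ts) (backup R i k ts)))"

definition candidate ::
  "('a, 'n::finite, 'm::finite) run \<Rightarrow> 'a \<Rightarrow> nat \<Rightarrow> real \<Rightarrow> ('n, 'm) traj" where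
  "candidate R i k ts =
     ((\<lambda>t. if t < ts then fst (nominal R i k) t else fst (backup R i k ts) t),
      (\<lambda>t. if t < ts then snd (nominal R i k) t else snd (backup R i k ts) t))"

definition valid_switch_times ::
  "('n::finite, 'm::finite, 'd::finite) sys \<Rightarrow> real \<Rightarrow> 'a set \<Rightarrow> real \<Rightarrow> ('n, 'm) traj \<Rightarrow>
   ('a, 'n, 'm) run \<Rightarrow> 'a \<Rightarrow> nat \<Rightarrow> real set" where
  "valid_switch_times \<Sigma> \<delta> V t0 ld R i k =
     {ts \<in> switch_steps R i k.
        valid \<Sigma> \<delta> V t0 ld (received R i k) i (iter_time R i k) (ts + join_duration R i k ts)
          (candidate R i k ts)}"

definition initially_valid ::
  "('n::finite, 'm::finite, 'd::finite) sys \<Rightarrow> real \<Rightarrow> 'a set \<Rightarrow> real \<Rightarrow> real \<Rightarrow> ('n, 'm) traj \<Rightarrow>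
   ('a, 'n, 'm) run \<Rightarrow> bool" where
  "initially_valid \<Sigma> \<delta> V TH t0 ld R \<longleftrightarrow>
     (\<forall>i\<in>V.
        trajectory \<Sigma> {t0..} (committed R i 0) \<and>
        fst (committed R i 0) t0 = agent_state R i t0 \<and>
        (\<exists>ts\<in>{t0..t0 + TH}. \<exists>TB\<ge>0.
           valid \<Sigma> \<delta> V t0 ld (\<lambda>j. committed R j 0) i t0 (ts + TB) (committed R i 0)))"

definition multi_agent_gatekeeper ::
  "('n::finite, 'm::finite, 'd::finite) sys \<Rightarrow> real \<Rightarrow> 'a set \<Rightarrow> 'a \<Rightarrow> real \<Rightarrow> real \<Rightarrow> ('n, 'm) traj \<Rightarrow>
   ('a, 'n, 'm) run \<Rightarrow> bool" where
  "multi_agent_gatekeeper \<Sigma> \<delta> V leader TH t0 ld R \<longleftrightarrow>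
     iters R leader = {0} \<and> committed R leader 0 = ld \<and>
     (\<forall>i\<in>V - {leader}. \<forall>k. Suc k \<in> iters R i \<longrightarrow>
        planning_data \<Sigma> TH t0 ld R i (Suc k) \<and>
        committed R i (Suc k) =
          (let I = valid_switch_times \<Sigma> \<delta> V t0 ld R i (Suc k) in
             if I \<noteq> {} then candidate R i (Suc k) (Max I) else committed R i k))"

end

theory Submission
  imports Defs
begin

text \<open>
  Two agents' committed trajectories that are in force simultaneously stay \<open>\<delta>\<close> apart forever,
  by induction on the number of iterations that the two agents have performed. Only the later of
  the two current iterations matters, and by sequential consistency it is strictly later (unless
  both are the initialization): the agent performing it either checked its new trajectory against
  the very trajectory that the other agent is committed to, or kept its previous one.
\<close>

text \<open>This is the guard under which \<open>executes_committed\<close> ties the state to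
  iteration \<open>k\<close>; after a last iteration it sets no upper bound on \<open>t\<close>.
  Unlike the \<open>Max\<close> in \<open>in_force\<close>, it is checked by comparing
  \<open>t\<close> with at most two iteration times.\<close>

definition current_iter :: "('a, 'n::finite, 'm::finite) run \<Rightarrow> 'a \<Rightarrow> nat \<Rightarrow> real \<Rightarrow> bool" where
  "current_iter R i k t \<longleftrightarrow>
     k \<in> iters R i \<and> iter_time R i k \<le> t \<and>
     (Suc k \<in> iters R i \<longrightarrow> t < iter_time R i (Suc k))"

lemma iters_downward_closed:
  assumes "planning_times V t0 R" "i \<in> V" "l \<in> iters R i" "k \<le> l"
  shows "k \<in> iters R i"
  using assms(4,3)
\<comment> \<open>Membership is given at \<open>l\<close> only, so the induction descends from
  there.\<close>
proof (induction rule: inc_induct)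
  case (step n)
  then show ?case using assms(1,2) by (auto simp: planning_times_def)
qed

lemma iter_time_strict_mono:
  assumes "planning_times V t0 R" "i \<in> V" "l \<in> iters R i" "k < l"
  shows "iter_time R i k < iter_time R i l"
  using assms(4,3)
proof (induction rule: strict_inc_induct)
  case (base k)
  then show ?case using assms(1,2) by (auto simp: planning_times_def)
next
  case (step k)
  then have "Suc k \<in> iters R i"
    using iters_downward_closed[OF assms(1,2)] by auto
  then have "iter_time R i k < iter_time R i (Suc k)"
    using assms(1,2) by (auto simp: planning_times_def)
  then show ?case using step by simp
qed

lemma iter_time_mono:
  assumes "planning_times V t0 R" "i \<in> V" "l \<in> iters R i" "k \<le> l"
  shows "iter_time R i k \<le> iter_time R i l"
  using iter_time_strict_mono[OF assms(1-3)] assms(4) by (auto simp: le_less)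

lemma iter_time_0:
  assumes "planning_times V t0 R" "i \<in> V"
  shows "iter_time R i 0 = t0"
  using assms by (simp add: planning_times_def)

text \<open>Iteration \<open>0\<close> at \<open>t0\<close> makes the set of past iterations
  nonempty, and its finiteness gives it a maximum.\<close>

lemma current_iter_exists:
  assumes "planning_times V t0 R" "i \<in> V" "t0 \<le> t"
  obtains k where "current_iter R i k t"
proof
  let ?K = "{k \<in> iters R i. iter_time R i k \<le> t}"
  have fin: "finite ?K" and "0 \<in> ?K" using assms by (auto simp: planning_times_def)
  then have "Max ?K \<in> ?K" using Max_in by blast
  moreover have "Suc (Max ?K) \<notin> ?K" using Max_ge[OF fin] Suc_n_not_le_n by blast
  ultimately show "current_iter R i (Max ?K) t" by (auto simp: current_iter_def)
qed

text \<open>Reconciles the \<open>Max\<close> that determines what is received with the guard that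
  determines what is executed: an index beyond \<open>k\<close> with time at most \<open>t\<close>
  would force \<open>Suc k\<close> to have occurred by \<open>t\<close> as well.\<close>

lemma in_force_current_iter:
  assumes "planning_times V t0 R" "i \<in> V" "current_iter R i k t"
  shows "in_force R i t = committed R i k"
proof -
  have "l \<le> k" if "l \<in> iters R i" "iter_time R i l \<le> t" for l
  proof (rule ccontr)
    assume "\<not> l \<le> k"
    then have "Suc k \<le> l" by simp
    then have "Suc k \<in> iters R i" "iter_time R i (Suc k) \<le> iter_time R i l"
      using iters_downward_closed[OF assms(1,2) that(1)] iter_time_mono[OF assms(1,2) that(1)]
      by auto
    then show False using assms(3) that(2) by (auto simp: current_iter_def)
  qed
  moreover have "finite {k \<in> iters R i. iter_time R i k \<le> t}"
    using assms(1,2) by (auto simp: planning_times_def)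
  ultimately have "Max {k \<in> iters R i. iter_time R i k \<le> t} = k"
    using assms(3) by (intro Max_eqI) (auto simp: current_iter_def)
  then show ?thesis by (simp add: in_force_def)
qed

lemma agent_state_current_iter:
  assumes "executes_committed \<Sigma> V t0 R" "i \<in> V" "current_iter R i k t"
  shows "agent_state R i t = fst (committed R i k) t"
  using assms by (auto simp: executes_committed_def current_iter_def)

lemma received_current_iter:
  assumes "planning_times V t0 R" "communications V E R"
    and "i \<in> V" "j \<in> V" "i \<noteq> j" "k \<in> iters R i"
    and "current_iter R j l (iter_time R i k)"
  shows "received R i k j = committed R j l"
proof -
  have "(i, j) \<in> E" using assms by (auto simp: communications_def)
  then have "received R i k j = in_force R j (iter_time R i k)"
    using assms(2,6) unfolding communications_def by blast
  then show ?thesis using in_force_current_iter[OF assms(1,4,7)] by simp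
qed

text \<open>Reduces an update to what the inductions use: the nominal and backup pieces of a
  candidate are forgotten, its validity is retained.\<close>

lemma committed_Suc_cases:
  assumes "multi_agent_gatekeeper \<Sigma> \<delta> V leader TH t0 ld R" "i \<in> V" "Suc k \<in> iters R i"
  obtains
    (kept) "committed R i (Suc k) = committed R i k"
  | (new) tB where "valid \<Sigma> \<delta> V t0 ld (received R i (Suc k)) i (iter_time R i (Suc k)) tB
      (committed R i (Suc k))"
proof -
  let ?I = "valid_switch_times \<Sigma> \<delta> V t0 ld R i (Suc k)"
  \<comment> \<open>The leader's only iteration index is \<open>0\<close>, so an index
    \<open>Suc k\<close> belongs to a follower.\<close>
  have "i \<noteq> leader" using assms by (auto simp: multi_agent_gatekeeper_def)
  then have data: "planning_data \<Sigma> TH t0 ld R i (Suc k)"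
    and upd: "committed R i (Suc k) =
      (if ?I \<noteq> {} then candidate R i (Suc k) (Max ?I) else committed R i k)"
    using assms by (auto simp: multi_agent_gatekeeper_def Let_def)
  show thesis
  proof (cases "?I = {}")
    case True
    then show thesis using upd kept by simp
  next
    case False
    \<comment> \<open>Finitely many switch steps are searched, so \<open>Max ?I\<close> is itself a
      valid switch time.\<close>
    have "finite ?I"
      using data by (auto simp: planning_data_def Let_def valid_switch_times_def)
    then have "Max ?I \<in> ?I" using False by (rule Max_in)
    then show thesis using upd False new by (auto simp: valid_switch_times_def)
  qed
qed

text \<open>No upper bound is put on \<open>t\<close>, since a kept trajectory must remain safe
  beyond the next iteration.\<close>

lemma committed_safe:
  assumes "planning_times V t0 R"
    and "initially_valid \<Sigma> \<delta> V TH t0 ld R"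
    and "multi_agent_gatekeeper \<Sigma> \<delta> V leader TH t0 ld R"
    and "i \<in> V" "k \<in> iters R i" "iter_time R i k \<le> t"
  shows "fst (committed R i k) t \<in> safe_set \<Sigma>"
  using assms(5,6)
proof (induction k)
  case 0
  then show ?case
    using assms(2,4) iter_time_0[OF assms(1,4)] by (auto simp: initially_valid_def valid_def)
next
  case (Suc k)
  from assms(3,4) Suc.prems(1) show ?case
  proof (cases rule: committed_Suc_cases)
    case kept
    have "k \<in> iters R i" "iter_time R i k \<le> t"
      using iters_downward_closed[OF assms(1,4) Suc.prems(1)]
        iter_time_mono[OF assms(1,4) Suc.prems(1), of k] Suc.prems(2) by auto
    then show ?thesis using Suc.IH kept by simp
  next
    case (new tB)
    then show ?thesis using Suc.prems(2) by (auto simp: valid_def)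
  qed
qed

text \<open>Two times are distinguished for the same reason: \<open>s\<close> witnesses that both
  iterations are current together, while \<open>t\<close> ranges over the whole future of
  \<open>s\<close>.\<close>

lemma committed_separated:
  assumes "planning_times V t0 R" "communications V E R" "sequentially_consistent V R"
    and "initially_valid \<Sigma> \<delta> V TH t0 ld R"
    and "multi_agent_gatekeeper \<Sigma> \<delta> V leader TH t0 ld R"
    and "i \<in> V" "j \<in> V" "i \<noteq> j"
    and "current_iter R i k s" "current_iter R j l s" "s \<le> t"
  shows "norm (pos \<Sigma> (fst (committed R i k) t) - pos \<Sigma> (fst (committed R j l) t)) \<ge> \<delta>"
  using assms(6-11)
proof (induction "k + l" arbitrary: i j k l s rule: less_induct)
  case less
  \<comment> \<open>The case in which \<open>i\<close> planned last, for fresh agents and indices so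
    that it also applies with the roles exchanged. The hypothesis \<open>IH\<close> allows a new
    \<open>s\<close>, as \<open>k'\<close> is current only before iteration
    \<open>k\<close>.\<close>
  have later: "norm (pos \<Sigma> (fst (committed R i k) t) - pos \<Sigma> (fst (committed R j l) t)) \<ge> \<delta>"
    if prems: "i \<in> V" "j \<in> V" "i \<noteq> j"
    "current_iter R i k s" "current_iter R j l s" "s \<le> t"
    and lt: "iter_time R j l < iter_time R i k"
    and IH: "\<And>k' s. k' < k \<Longrightarrow> current_iter R i k' s \<Longrightarrow> current_iter R j l s \<Longrightarrow> s \<le> t \<Longrightarrow>
      norm (pos \<Sigma> (fst (committed R i k') t) - pos \<Sigma> (fst (committed R j l) t)) \<ge> \<delta>"
    for i j k l s
  proof -
    have k: "k \<in> iters R i" and l: "l \<in> iters R j"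
      using prems(4,5) by (auto simp: current_iter_def)
    have "t0 \<le> iter_time R j l"
      using iter_time_mono[OF assms(1) prems(2) l, of 0] iter_time_0[OF assms(1) prems(2)] by simp
    \<comment> \<open>Iteration \<open>0\<close> happens at \<open>t0\<close>, which is not later
      than any iteration of \<open>j\<close>.\<close>
    then obtain k' where k': "k = Suc k'"
      using lt iter_time_0[OF assms(1) prems(1)] by (cases k) auto
    \<comment> \<open>Iteration \<open>l\<close> began before \<open>i\<close> planned and is not
      superseded by time \<open>s\<close>, so it is what \<open>i\<close> receives.\<close>
    have curj: "current_iter R j l (iter_time R i k)"
      using prems(4,5) lt by (auto simp: current_iter_def)
    from assms(5) prems(1) k[unfolded k'] show ?thesis
    proof (cases rule: committed_Suc_cases)
      case kept
      have k'_iters: "k' \<in> iters R i" and step: "iter_time R i k' < iter_time R i k"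
        using iters_downward_closed[OF assms(1) prems(1) k]
          iter_time_strict_mono[OF assms(1) prems(1) k, of k'] k' by auto
      \<comment> \<open>The first time at which \<open>k'\<close> and \<open>l\<close> have both
        begun; it precedes iteration \<open>k\<close>, hence also \<open>s\<close>, so neither has
        been superseded.\<close>
      let ?s = "max (iter_time R i k') (iter_time R j l)"
      have "current_iter R i k' ?s" "current_iter R j l ?s" "?s \<le> t"
        using k'_iters step lt k' prems(4-6) by (auto simp: current_iter_def)
      then show ?thesis using IH[of k' ?s] kept k' by simp
    next
      case (new tB)
      have "received R i k j = committed R j l"
        by (rule received_current_iter[OF assms(1,2) prems(1-3) k curj])
      moreover have "iter_time R i k \<le> t"
        using prems(4,6) by (auto simp: current_iter_def)
      moreover have "j \<in> V - {i}" using prems(2,3) by simp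
      ultimately show ?thesis using new unfolding k' valid_def by metis
    qed
  qed
  have k: "k \<in> iters R i" and l: "l \<in> iters R j"
    using less.prems(4,5) by (auto simp: current_iter_def)
  \<comment> \<open>Sequential consistency excludes ties between nonzero indices; if one index is
    \<open>0\<close>, a tie at \<open>t0\<close> forces the other to be \<open>0\<close>.\<close>
  consider "k = 0" "l = 0" | "iter_time R j l < iter_time R i k"
    | "iter_time R i k < iter_time R j l"
  proof (cases "k = 0 \<or> l = 0")
    case True
    then show thesis
      using that iter_time_strict_mono[OF assms(1) less.prems(1) k, of 0]
        iter_time_strict_mono[OF assms(1) less.prems(2) l, of 0]
        iter_time_0[OF assms(1) less.prems(1)] iter_time_0[OF assms(1) less.prems(2)]
      by (metis neq0_conv)
  next
    case False
    then have "iter_time R i k \<noteq> iter_time R j l"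
      using assms(3) less.prems(1-3) k l by (auto simp: sequentially_consistent_def)
    then show thesis using that by linarith
  qed
  then show ?case
  proof cases
    case 1
    have "iter_time R i 0 \<le> t"
      using less.prems(4,6) 1 by (auto simp: current_iter_def)
    then have "t0 \<le> t" using iter_time_0[OF assms(1) less.prems(1)] by simp
    then show ?thesis
      using assms(4) less.prems(1-3) 1 by (auto simp: initially_valid_def valid_def)
  next
    case 2
    show ?thesis
      by (rule later[OF less.prems 2]) (rule less.hyps, use less.prems in auto)
  next
    case 3
    \<comment> \<open>Exchanging the agents preserves the measure \<open>k + l\<close>, so
      \<open>less.hyps\<close> still supplies \<open>IH\<close>.\<close>
    have "norm (pos \<Sigma> (fst (committed R j l) t) - pos \<Sigma> (fst (committed R i k) t)) \<ge> \<delta>"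
      by (rule later[OF less.prems(2,1) not_sym[OF less.prems(3)] less.prems(5,4,6) 3])
        (rule less.hyps, use less.prems in auto)
    then show ?thesis by (simp add: norm_minus_commute)
  qed
qed

theorem theorem1:
  fixes \<Sigma> :: "('n::finite, 'm::finite, 'd::finite) sys"
    and V :: "'a set" and leader :: 'a and E :: "('a \<times> 'a) set"
    and N :: nat and \<delta> \<epsilon> t0 tf TH :: real
    and ld :: "('n, 'm) traj"
    and R :: "('a, 'n, 'm) run"
  assumes system: "control_system \<Sigma>"
    and agents: "finite V" "card V = N" "leader \<in> V"
    and parameters: "\<delta> > 0" "TH \<ge> 0" "0 \<le> t0" "t0 \<le> tf"
    and leader_trajectory: "trajectory \<Sigma> {t0..} ld"
    and iterations: "planning_times V t0 R"
    and execution: "executes_committed \<Sigma> V t0 R"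
    and communication: "communications V E R"
    and sequential: "sequentially_consistent V R"
    and backup: "valid_trajectory_backup_set \<Sigma> \<delta> t0 tf ld"
    and margin: "curvature_margin \<Sigma> \<delta> t0 tf ld \<epsilon>" "joint_separation \<Sigma> \<delta> t0 tf ld \<epsilon>"
    and initial: "initially_valid \<Sigma> \<delta> V TH t0 ld R"
    and updates: "multi_agent_gatekeeper \<Sigma> \<delta> V leader TH t0 ld R"
  shows "\<forall>t\<ge>t0.
           (\<forall>i\<in>V. agent_state R i t \<in> safe_set \<Sigma>) \<and>
           (\<forall>i\<in>V. \<forall>j\<in>V. i \<noteq> j \<longrightarrow>
              norm (pos \<Sigma> (agent_state R i t) - pos \<Sigma> (agent_state R j t)) \<ge> \<delta>)"
proof (intro allI impI conjI ballI)
  fix t i assume "t0 \<le> t" and i: "i \<in> V"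
  then obtain k where k: "current_iter R i k t"
    using current_iter_exists[OF iterations] by blast
  then show "agent_state R i t \<in> safe_set \<Sigma>"
    using committed_safe[OF iterations initial updates i]
      agent_state_current_iter[OF execution i k] by (auto simp: current_iter_def)
next
  fix t i j assume "t0 \<le> t" and ij: "i \<in> V" "j \<in> V" "i \<noteq> j"
  then obtain k l where k: "current_iter R i k t" and l: "current_iter R j l t"
    using current_iter_exists[OF iterations] by metis
  \<comment> \<open>Separation is applied with \<open>s\<close> equal to \<open>t\<close>, where the
    states are those of the committed trajectories.\<close>
  show "norm (pos \<Sigma> (agent_state R i t) - pos \<Sigma> (agent_state R j t)) \<ge> \<delta>"
    using committed_separated[OF iterations communication sequential initial updates ij k l]
      agent_state_current_iter[OF execution ij(1) k] agent_state_current_iter[OF execution ij(2) l]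
    by simp
qed

end
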